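(* Let $X$ be a real random variable with distribution $F$ on $\mathbb{R}$ and characteristic function $\phi$, let $n\ge 0$ be an integer and let $2n<s<2n+2$. Then $$\mu_{s}={\bf E}[|X|^s]=\frac{2}{\pi}\,\Gamma(s+1)\,\sin\!\left(\frac{(s-2n)\pi}{2}\right)\int_0^{\infty}\frac{{\bf E}[g_n(tX)]}{t^{s+1}}\,dt,$$ as an equality in $[0,\infty]$ (both sides finite and equal, or both infinite). If, in addition, $\mu_s<\infty$ for some $s\in(2n,2n+2)$ with integer $n\ge 0$, then $$\mu_{s}=\frac{2}{\pi}\,\Gamma(s+1)\,\sin\!\left(\frac{(s-2n)\pi}{2}\right)\int_0^{\infty}\frac{G_n(t)}{t^{s+1}}\,dt .$$
   Context: The characteristic function is $\phi(t)={\bf E}[e^{itX}]$, $t\in\mathbb{R}$. Write $m_k={\bf E}[X^k]$ for the moments (when finite) and $\mu_s={\bf E}[|X|^s]$. For an integer $n\ge 0$ define $$g_n(t)=(-1)^{n+1}\biggl(\cos t-\sum_{k=0}^n\frac{(-1)^k}{(2k)!}t^{2k}\biggr),\quad t\in\mathbb{R};$$ this even function satisfies $g_n\ge 0$ on $\mathbb{R}$, so that ${\bf E}[g_n(tX)]\in[0,\infty]$ is always defined. Provided the moments are finite, define $$G_n(t)=(-1)^{n+1}\biggl(\mathrm{Re}(\phi(t))-\sum_{k=0}^n\frac{(-1)^k}{(2k)!}m_{2k}t^{2k}\biggr),\quad t\in\mathbb{R}.$$ *)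

theory Defs
  imports "HOL-Probability.Probability"
begin

text \<open>Absolute moments take values in \<^term>\<open>{0..\<infinity>} :: ennreal set\<close>, so that they exist
  without any integrability assumption.\<close>

definition abs_moment :: "'a measure \<Rightarrow> ('a \<Rightarrow> real) \<Rightarrow> real \<Rightarrow> ennreal" where
  "abs_moment M X s = (\<integral>\<^sup>+ \<omega>. ennreal (\<bar>X \<omega>\<bar> powr s) \<partial>M)"

definition moment :: "'a measure \<Rightarrow> ('a \<Rightarrow> real) \<Rightarrow> nat \<Rightarrow> real" where
  "moment M X k = (\<integral>\<omega>. X \<omega> ^ k \<partial>M)"

definition g :: "nat \<Rightarrow> real \<Rightarrow> real" where
  "g n t = (-1) ^ (n + 1) * (cos t - (\<Sum>k=0..n. (-1) ^ k / fact (2 * k) * t ^ (2 * k)))"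

text \<open>Only meaningful when the moments of order at most \<open>2 * n\<close> are finite.\<close>

definition G :: "'a measure \<Rightarrow> ('a \<Rightarrow> real) \<Rightarrow> nat \<Rightarrow> real \<Rightarrow> real" where
  "G M X n t = (-1) ^ (n + 1) *
     (Re (char (distr M borel X) t)
       - (\<Sum>k=0..n. (-1) ^ k / fact (2 * k) * moment M X (2 * k) * t ^ (2 * k)))"

text \<open>By nonnegativity, the coercion \<open>ennreal (g n x)\<close> does not truncate.\<close>

lemma g_nonneg: "0 \<le> g n t"
proof -
  obtain u where u: "cos t = (\<Sum>m<2*n. cos_coeff m * t ^ m)
      + (cos (u + 1/2 * real (2*n) * pi) / fact (2*n)) * t ^ (2*n)"
    using Maclaurin_cos_expansion[of t "2*n"] by blast
  have c: "cos (u + 1/2 * real (2*n) * pi) = (-1) ^ n * cos u"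
    by (simp add: cos_add)
  have s: "(\<Sum>m<2*n. cos_coeff m * t ^ m)
      = (\<Sum>k<n. (-1) ^ k / fact (2 * k) * t ^ (2 * k))" for n
    by (induction n) (auto simp: cos_coeff_def)
  have t: "(\<Sum>k=0..n. (-1) ^ k / fact (2 * k) * t ^ (2 * k))
      = (\<Sum>k<n. (-1) ^ k / fact (2 * k) * t ^ (2 * k)) + (-1) ^ n / fact (2 * n) * t ^ (2 * n)"
    by (simp add: atLeast0AtMost flip: lessThan_Suc_atMost)
  have "cos t - (\<Sum>k=0..n. (-1) ^ k / fact (2 * k) * t ^ (2 * k))
      = (-1) ^ n * ((cos u - 1) * (t ^ (2*n) / fact (2*n)))"
    unfolding u c s t by (simp add: algebra_simps diff_divide_distrib)
  then have "g n t = (1 - cos u) * (t ^ (2*n) / fact (2*n))"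
    unfolding g_def by (simp add: algebra_simps flip: power_add mult.assoc)
  then show ?thesis by simp
qed

text \<open>Finiteness of the absolute moment in the range at hand makes every moment occurring in
  \<^const>\<open>G\<close> finite.\<close>

lemma integrable_even_moment:
  assumes "prob_space M" and X: "X \<in> borel_measurable M"
    and "2 * real n < s" and fin: "abs_moment M X s < \<infinity>" and "k \<le> n"
  shows "integrable M (\<lambda>\<omega>. X \<omega> ^ (2 * k))"
proof -
  interpret prob_space M by fact
  have "integrable M (\<lambda>\<omega>. \<bar>X \<omega>\<bar> powr s)"
    using fin X unfolding abs_moment_def by (intro integrableI_nonneg) auto
  then have i: "integrable M (\<lambda>\<omega>. 1 + \<bar>X \<omega>\<bar> powr s)" by simp
  have b: "\<bar>x\<bar> ^ (2 * k) \<le> 1 + \<bar>x\<bar> powr s" for x :: real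
  proof (cases "\<bar>x\<bar> \<le> 1")
    case True
    then have "\<bar>x\<bar> ^ (2 * k) \<le> 1" by (intro power_le_one) auto
    then show ?thesis using powr_ge_zero[of "\<bar>x\<bar>" s] by linarith
  next
    case False
    then have "\<bar>x\<bar> ^ (2 * k) = \<bar>x\<bar> powr real (2 * k)" by (intro powr_realpow[symmetric]) auto
    also have "\<dots> \<le> \<bar>x\<bar> powr s" using False assms by (intro powr_mono) auto
    finally show ?thesis by simp
  qed
  show ?thesis
    using X b by (intro Bochner_Integration.integrable_bound[OF i]) (auto simp: power_abs)
qed

end

theory Submission
  imports Defs "HOL-Real_Asymp.Real_Asymp"
begin

text \<open>
  Everything reduces to the Mellin-type integral of the deterministic function \<^term>\<open>g n\<close>:
  for \<open>2n < s < 2n + 2\<close> (the range in which it converges, as \<open>g n\<close> grows like \<open>t ^ (2n)\<close>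
  at infinity, or is bounded if \<open>n = 0\<close>, and vanishes like \<open>t ^ (2n + 2)\<close> at \<open>0\<close>),
  the integral of \<open>g n t / t powr (s + 1)\<close> over the positive half-line is
  \<open>\<pi> / (2 \<Gamma>(s + 1) sin ((s - 2n) \<pi> / 2))\<close> (lemma \<open>mellin_g\<close>). Replacing \<open>t\<close> by \<open>t x\<close>
  multiplies this integral by \<open>\<bar>x\<bar> powr s\<close>, so \<open>\<bar>x\<bar> powr s\<close> is a constant times the integral of
  \<open>g n (t x) / t powr (s + 1)\<close> (lemma \<open>abs_powr_eq_nn_integral_g\<close>). Putting \<open>x = X \<omega>\<close> and taking
  expectations gives the first formula; as \<open>g n \<ge> 0\<close>, expectation and integral may be
  exchanged by Tonelli's theorem, with both sides in \<open>[0, \<infinity>]\<close>. When the moments exist,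
  \<open>E[g n (t X)]\<close> is \<^term>\<open>G M X n t\<close> by linearity of the expectation, which gives the second.

  To compute the Mellin-type integral, write \<open>\<Gamma>(s + 1) / t powr (s + 1)\<close> as the integral of
  \<open>u powr s * exp (- t u)\<close> over \<open>u\<close> and exchange the integrals. The inner integral is then the
  Laplace transform of \<open>g n\<close>, which is the rational function \<open>1 / (u ^ (2n + 1) (1 + u\<^sup>2))\<close>
  (lemma \<open>laplace_g\<close>), and what is left is the integral of \<open>u powr (s - 2n - 1) / (1 + u\<^sup>2)\<close>.
  By a substitution and one more use of Tonelli's theorem it equals half of
  \<open>\<Gamma>(a) \<Gamma>(1 - a)\<close> with \<open>a = (s - 2n) / 2\<close>, to which the reflection formula applies.
\<close>

section \<open>Integrals over the positive half-line\<close>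

lemma nn_integral_Ioi_cmult_arg:
  fixes f :: "real \<Rightarrow> ennreal"
  assumes [measurable]: "f \<in> borel_measurable borel" and c: "c > 0"
  shows "ennreal c * (\<integral>\<^sup>+x\<in>{0<..}. f (c * x) \<partial>lborel) = (\<integral>\<^sup>+x\<in>{0<..}. f x \<partial>lborel)"
proof -
  have "(\<integral>\<^sup>+x\<in>{0<..}. f x \<partial>lborel)
      = \<bar>c\<bar> * (\<integral>\<^sup>+x. f (0 + c * x) * indicator {0<..} (0 + c * x) \<partial>lborel)"
    using c by (intro nn_integral_real_affine) auto
  also have "(\<integral>\<^sup>+x. f (0 + c * x) * indicator {0<..} (0 + c * x) \<partial>lborel)
      = (\<integral>\<^sup>+x\<in>{0<..}. f (c * x) \<partial>lborel)"
    using c by (intro nn_integral_cong) (simp add: indicator_def zero_less_mult_iff)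
  finally show ?thesis using c by simp
qed

lemma nn_integral_Ioi_swap:
  fixes f :: "real \<Rightarrow> real \<Rightarrow> ennreal"
  assumes [measurable]: "case_prod f \<in> borel_measurable (borel \<Otimes>\<^sub>M borel)"
  shows "(\<integral>\<^sup>+x\<in>{0<..}. (\<integral>\<^sup>+y\<in>{0<..}. f x y \<partial>lborel) \<partial>lborel)
       = (\<integral>\<^sup>+y\<in>{0<..}. (\<integral>\<^sup>+x\<in>{0<..}. f x y \<partial>lborel) \<partial>lborel)"
proof -
  have "(\<integral>\<^sup>+x\<in>{0<..}. (\<integral>\<^sup>+y\<in>{0<..}. f x y \<partial>lborel) \<partial>lborel)
      = (\<integral>\<^sup>+x. \<integral>\<^sup>+y. f x y * indicator {0<..} y * indicator {0<..} x \<partial>lborel \<partial>lborel)"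
    by (intro nn_integral_cong nn_integral_multc [symmetric]) measurable
  also have "\<dots> = (\<integral>\<^sup>+y. \<integral>\<^sup>+x. f x y * indicator {0<..} y * indicator {0<..} x \<partial>lborel \<partial>lborel)"
    by (intro lborel_pair.Fubini' [symmetric]) measurable
  also have "\<dots> = (\<integral>\<^sup>+y. \<integral>\<^sup>+x. f x y * indicator {0<..} x * indicator {0<..} y \<partial>lborel \<partial>lborel)"
    by (simp add: mult_ac)
  also have "\<dots> = (\<integral>\<^sup>+y\<in>{0<..}. (\<integral>\<^sup>+x\<in>{0<..}. f x y \<partial>lborel) \<partial>lborel)"
    by (intro nn_integral_cong nn_integral_multc) measurable
  finally show ?thesis .
qed

lemma nn_integral_Ioi_eq_Ici:
  fixes f :: "real \<Rightarrow> ennreal"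
  shows "(\<integral>\<^sup>+x\<in>{0<..}. f x \<partial>lborel) = (\<integral>\<^sup>+x\<in>{0..}. f x \<partial>lborel)"
proof (intro nn_integral_cong_AE)
  show "AE x in lborel. f x * indicator {0<..} x = f x * indicator {0..} x"
    using AE_lborel_singleton[of "0::real"] by eventually_elim (auto simp: indicator_def)
qed

text \<open>The change of variables theorem for the Henstock--Kurzweil integral is an equivalence between
  two integrability statements, so a finite value on one side has to be given.\<close>

lemma nn_integral_Ioi_square_subst:
  fixes f :: "real \<Rightarrow> real"
  assumes [measurable]: "f \<in> borel_measurable borel"
    and nonneg: "\<And>x. x > 0 \<Longrightarrow> 0 \<le> f x"
    and val: "(\<integral>\<^sup>+x\<in>{0<..}. ennreal (f x) \<partial>lborel) = ennreal b" and b: "b \<ge> 0"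
  shows "(\<integral>\<^sup>+x\<in>{0<..}. ennreal (2 * x * f (x\<^sup>2)) \<partial>lborel) = ennreal b"
proof -
  have "((\<lambda>x. indicator {0<..} x * f x) has_integral b) UNIV"
  proof (rule nn_integral_has_integral)
    have "(\<integral>\<^sup>+x. ennreal (indicator {0<..} x * f x) \<partial>lborel) = (\<integral>\<^sup>+x\<in>{0<..}. ennreal (f x) \<partial>lborel)"
      by (intro nn_integral_cong) (auto simp: indicator_def)
    with val show "(\<integral>\<^sup>+x. ennreal (indicator {0<..} x * f x) \<partial>lborel) = ennreal b" by simp
  qed (use nonneg b in \<open>auto simp: indicator_def\<close>)
  also have "(\<lambda>x. indicator {0<..} x * f x) = (\<lambda>x. if x \<in> {0<..} then f x else 0)"
    by (auto simp: indicator_def)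
  finally have hi: "(f has_integral b) {0<..}"
    by (simp only: has_integral_restrict_UNIV)
  have im: "(\<lambda>x::real. x\<^sup>2) ` {0<..} = {0<..}"
  proof (intro equalityI subsetI)
    fix y :: real assume "y \<in> {0<..}"
    then show "y \<in> (\<lambda>x. x\<^sup>2) ` {0<..}" by (intro image_eqI[of _ _ "sqrt y"]) auto
  qed auto
  have "f absolutely_integrable_on {0<..} \<and> integral {0<..} f = b"
    using hi nonneg by (auto intro!: nonnegative_absolutely_integrable_1 simp: integral_unique)
  then have "(\<lambda>x. \<bar>2 * x\<bar> * f (x\<^sup>2)) absolutely_integrable_on {0<..} \<and>
      integral {0<..} (\<lambda>x. \<bar>2 * x\<bar> * f (x\<^sup>2)) = b"
    by (subst has_absolute_integral_change_of_variables_1' [where g = "\<lambda>x. x\<^sup>2"])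
       (auto simp: im inj_on_def intro!: derivative_eq_intros)
  then have "((\<lambda>x. \<bar>2 * x\<bar> * f (x\<^sup>2)) has_integral b) {0<..}"
    using set_lebesgue_integral_eq_integral(1) by (auto simp: has_integral_iff)
  then have "((\<lambda>x. 2 * x * f (x\<^sup>2)) has_integral b) {0<..}"
    by (rule has_integral_eq [rotated]) auto
  then show ?thesis
    using nonneg by (intro nn_integral_has_integral_lebesgue') auto
qed

section \<open>Two integrals evaluated by the Gamma function\<close>

lemma nn_integral_powr_times_exp:
  fixes a t :: real
  assumes a: "a > 0" and t: "t > 0"
  shows "(\<integral>\<^sup>+u\<in>{0<..}. ennreal (u powr (a - 1) * exp (- (t * u))) \<partial>lborel)
       = ennreal (Gamma a / t powr a)"
proof -
  have 1: "(\<integral>\<^sup>+u\<in>{0<..}. ennreal (u powr (a - 1) * exp (- u)) \<partial>lborel) = ennreal (Gamma a)"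
    unfolding nn_integral_Ioi_eq_Ici Gamma_conv_nn_integral_real[OF a]
    by (intro nn_integral_cong) (auto simp: indicator_def exp_minus divide_inverse)
  let ?J = "\<integral>\<^sup>+u\<in>{0<..}. ennreal (u powr (a - 1) * exp (- (t * u))) \<partial>lborel"
  have "ennreal (Gamma a)
      = ennreal t * (\<integral>\<^sup>+u\<in>{0<..}. ennreal ((t * u) powr (a - 1) * exp (- (t * u))) \<partial>lborel)"
    using nn_integral_Ioi_cmult_arg[of "\<lambda>u. ennreal (u powr (a - 1) * exp (- u))" t] t 1 by simp
  also have "(\<integral>\<^sup>+u\<in>{0<..}. ennreal ((t * u) powr (a - 1) * exp (- (t * u))) \<partial>lborel)
      = (\<integral>\<^sup>+u. ennreal (t powr (a - 1))
           * (ennreal (u powr (a - 1) * exp (- (t * u))) * indicator {0<..} u) \<partial>lborel)"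
    using t by (intro nn_integral_cong)
      (auto simp: indicator_def powr_mult ennreal_mult' [symmetric] mult_ac)
  also have "\<dots> = ennreal (t powr (a - 1)) * ?J"
    by (intro nn_integral_cmult) measurable
  also have "ennreal t * (ennreal (t powr (a - 1)) * ?J) = ennreal (t powr a) * ?J"
  proof -
    have "t * t powr (a - 1) = t powr a"
      using t by (simp add: powr_diff)
    then show ?thesis
      using t by (simp add: mult.assoc [symmetric] ennreal_mult' [symmetric])
  qed
  finally have "ennreal (Gamma a) = ennreal (t powr a) * ?J" .
  then have "ennreal (1 / t powr a) * ennreal (Gamma a)
      = (ennreal (1 / t powr a) * ennreal (t powr a)) * ?J"
    by (simp add: mult.assoc)
  also have "ennreal (1 / t powr a) * ennreal (t powr a) = 1"
    using t by (simp add: ennreal_mult' [symmetric])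
  finally show ?thesis
    by (simp add: ennreal_mult' [symmetric])
qed

lemma nn_integral_power_times_exp:
  fixes u :: real
  assumes "u > 0"
  shows "(\<integral>\<^sup>+t\<in>{0<..}. ennreal (t ^ k * exp (- (t * u))) \<partial>lborel) = ennreal (fact k / u ^ Suc k)"
proof -
  have "(\<integral>\<^sup>+t\<in>{0<..}. ennreal (t ^ k * exp (- (t * u))) \<partial>lborel)
      = (\<integral>\<^sup>+t\<in>{0<..}. ennreal (t powr (real (Suc k) - 1) * exp (- (u * t))) \<partial>lborel)"
    by (intro nn_integral_cong) (auto simp: indicator_def powr_realpow mult.commute)
  also have "\<dots> = ennreal (Gamma (real (Suc k)) / u powr real (Suc k))"
    using assms by (intro nn_integral_powr_times_exp) auto
  also have "Gamma (real (Suc k)) = fact k"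
    using Gamma_fact[of k, where 'a = real] by (simp add: add.commute)
  also have "u powr real (Suc k) = u ^ Suc k"
    using assms by (intro powr_realpow)
  finally show ?thesis .
qed

text \<open>Writing \<open>1 / (1 + v)\<close> as the integral of \<open>exp (- w (1 + v))\<close> over \<open>w\<close> and integrating over
  \<open>v\<close> first produces two Gamma integrals, so the value is \<open>\<Gamma>(a) \<Gamma>(1 - a)\<close>.\<close>

lemma mellin_1_over_1_plus:
  fixes a :: real
  assumes a: "0 < a" "a < 1"
  shows "(\<integral>\<^sup>+v\<in>{0<..}. ennreal (v powr (a - 1) / (1 + v)) \<partial>lborel) = ennreal (pi / sin (pi * a))"
proof -
  have "(\<integral>\<^sup>+v\<in>{0<..}. ennreal (v powr (a - 1) / (1 + v)) \<partial>lborel)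
      = (\<integral>\<^sup>+v\<in>{0<..}. (\<integral>\<^sup>+w\<in>{0<..}. ennreal (v powr (a - 1) * exp (- (w * v)) * exp (- w)) \<partial>lborel) \<partial>lborel)"
  proof (intro set_nn_integral_cong refl)
    fix v :: real assume "v \<in> space lborel \<inter> {0<..}"
    then have v: "v > 0" by simp
    have "(\<integral>\<^sup>+w\<in>{0<..}. ennreal (v powr (a - 1) * exp (- (w * v)) * exp (- w)) \<partial>lborel)
        = (\<integral>\<^sup>+w. ennreal (v powr (a - 1)) * (ennreal (w ^ 0 * exp (- (w * (1 + v)))) * indicator {0<..} w) \<partial>lborel)"
      by (intro nn_integral_cong)
         (auto simp: indicator_def ennreal_mult' [symmetric] algebra_simps simp flip: exp_add)
    also have "\<dots> = ennreal (v powr (a - 1)) * (\<integral>\<^sup>+w\<in>{0<..}. ennreal (w ^ 0 * exp (- (w * (1 + v)))) \<partial>lborel)"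
      by (intro nn_integral_cmult) measurable
    also have "\<dots> = ennreal (v powr (a - 1) / (1 + v))"
      using v by (subst nn_integral_power_times_exp) (auto simp: ennreal_mult' [symmetric])
    finally show "ennreal (v powr (a - 1) / (1 + v))
        = (\<integral>\<^sup>+w\<in>{0<..}. ennreal (v powr (a - 1) * exp (- (w * v)) * exp (- w)) \<partial>lborel)" ..
  qed
  also have "\<dots> = (\<integral>\<^sup>+w\<in>{0<..}. (\<integral>\<^sup>+v\<in>{0<..}. ennreal (v powr (a - 1) * exp (- (w * v)) * exp (- w)) \<partial>lborel) \<partial>lborel)"
    by (intro nn_integral_Ioi_swap) measurable
  also have "\<dots> = (\<integral>\<^sup>+w. ennreal (Gamma a) * (ennreal (w powr ((1 - a) - 1) * exp (- (1 * w))) * indicator {0<..} w) \<partial>lborel)"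
  proof (intro nn_integral_cong)
    fix w :: real
    show "(\<integral>\<^sup>+v\<in>{0<..}. ennreal (v powr (a - 1) * exp (- (w * v)) * exp (- w)) \<partial>lborel) * indicator {0<..} w
        = ennreal (Gamma a) * (ennreal (w powr ((1 - a) - 1) * exp (- (1 * w))) * indicator {0<..} w)"
    proof (cases "w > 0")
      case w: True
      have "(\<integral>\<^sup>+v\<in>{0<..}. ennreal (v powr (a - 1) * exp (- (w * v)) * exp (- w)) \<partial>lborel)
          = (\<integral>\<^sup>+v. ennreal (v powr (a - 1) * exp (- (w * v))) * indicator {0<..} v * ennreal (exp (- w)) \<partial>lborel)"
        by (intro nn_integral_cong) (auto simp: indicator_def ennreal_mult' [symmetric])
      also have "\<dots> = (\<integral>\<^sup>+v\<in>{0<..}. ennreal (v powr (a - 1) * exp (- (w * v))) \<partial>lborel) * ennreal (exp (- w))"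
        by (intro nn_integral_multc) measurable
      also have "\<dots> = ennreal (Gamma a * (w powr - a * exp (- w)))"
        using w a
        by (subst nn_integral_powr_times_exp)
           (auto simp: ennreal_mult'' [symmetric] powr_minus divide_inverse mult.assoc)
      also have "\<dots> = ennreal (Gamma a) * ennreal (w powr - a * exp (- w))"
        by (intro ennreal_mult'') simp
      finally show ?thesis using w by simp
    qed simp
  qed
  also have "\<dots> = ennreal (Gamma a) * (\<integral>\<^sup>+w\<in>{0<..}. ennreal (w powr ((1 - a) - 1) * exp (- (1 * w))) \<partial>lborel)"
    by (intro nn_integral_cmult) measurable
  also have "\<dots> = ennreal (Gamma a * Gamma (1 - a))"
    using a by (subst nn_integral_powr_times_exp) (auto simp: ennreal_mult'' [symmetric])
  also have "Gamma a * Gamma (1 - a) = pi / sin (pi * a)"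
  proof -
    have "complex_of_real (Gamma a * Gamma (1 - a)) = complex_of_real (pi / sin (pi * a))"
      using Gamma_reflection_complex[of "complex_of_real a"]
      by (simp add: Gamma_complex_of_real [symmetric] sin_of_real [symmetric])
    then show ?thesis by (simp only: of_real_eq_iff)
  qed
  finally show ?thesis .
qed

lemma mellin_1_over_1_plus_square:
  fixes b :: real
  assumes b: "0 < b" "b < 2"
  shows "(\<integral>\<^sup>+u\<in>{0<..}. ennreal (u powr (b - 1) / (1 + u\<^sup>2)) \<partial>lborel)
       = ennreal (pi / (2 * sin (b * pi / 2)))"
proof -
  have sin: "sin (pi * (b / 2)) > 0"
    using b by (intro sin_gt_zero) auto
  have "(\<integral>\<^sup>+u\<in>{0<..}. ennreal (u powr (b - 1) / (1 + u\<^sup>2)) \<partial>lborel)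
      = (\<integral>\<^sup>+u. ennreal (1 / 2) * (ennreal (2 * u * ((u\<^sup>2) powr (b / 2 - 1) / (1 + u\<^sup>2))) * indicator {0<..} u) \<partial>lborel)"
  proof (intro nn_integral_cong)
    fix u :: real
    have "u * (u\<^sup>2) powr (b / 2 - 1) = u powr (b - 1)" if "u > 0"
    proof -
      have "(u\<^sup>2) powr (b / 2 - 1) = (u powr 2) powr (b / 2 - 1)"
        using that by simp
      also have "\<dots> = u powr (b - 2)"
        unfolding powr_powr by (simp add: algebra_simps)
      finally have "u * (u\<^sup>2) powr (b / 2 - 1) = u powr 1 * u powr (b - 2)"
        using that by simp
      then show ?thesis unfolding powr_add [symmetric] by simp
    qed
    then have "u powr (b - 1) / (1 + u\<^sup>2) = 1 / 2 * (2 * u * ((u\<^sup>2) powr (b / 2 - 1) / (1 + u\<^sup>2)))" if "u > 0"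
      using that by simp
    then have "ennreal (u powr (b - 1) / (1 + u\<^sup>2))
        = ennreal (1 / 2) * ennreal (2 * u * ((u\<^sup>2) powr (b / 2 - 1) / (1 + u\<^sup>2)))" if "u > 0"
      using that by (subst ennreal_mult' [symmetric]) auto
    then show "ennreal (u powr (b - 1) / (1 + u\<^sup>2)) * indicator {0<..} u
        = ennreal (1 / 2) * (ennreal (2 * u * ((u\<^sup>2) powr (b / 2 - 1) / (1 + u\<^sup>2))) * indicator {0<..} u)"
      by (cases "u > 0") (simp_all only: indicator_simps greaterThan_iff mult_1_right mult_zero_right not_False_eq_True)
  qed
  also have "\<dots> = ennreal (1 / 2) * (\<integral>\<^sup>+u\<in>{0<..}. ennreal (2 * u * ((u\<^sup>2) powr (b / 2 - 1) / (1 + u\<^sup>2))) \<partial>lborel)"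
    by (intro nn_integral_cmult) measurable
  also have "(\<integral>\<^sup>+u\<in>{0<..}. ennreal (2 * u * ((u\<^sup>2) powr (b / 2 - 1) / (1 + u\<^sup>2))) \<partial>lborel)
      = ennreal (pi / sin (pi * (b / 2)))"
    using b sin
    by (intro nn_integral_Ioi_square_subst[where f = "\<lambda>v. v powr (b / 2 - 1) / (1 + v)"]
        mellin_1_over_1_plus) auto
  also have "ennreal (1 / 2) * ennreal (pi / sin (pi * (b / 2))) = ennreal (pi / (2 * sin (b * pi / 2)))"
    by (subst ennreal_mult' [symmetric]) (auto simp: mult.commute)
  finally show ?thesis .
qed

section \<open>The Laplace transform of the cosine remainder\<close>

lemma measurable_g [measurable]: "g n \<in> borel_measurable borel"
  unfolding g_def by measurable

lemma g_abs: "g n \<bar>x\<bar> = g n x"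
  by (simp add: g_def power_mult)

text \<open>The cosine enters \<^term>\<open>g n\<close> with sign \<open>(-1) ^ (n + 1)\<close>, so the cosines cancel and only the new Taylor term
  remains. This drives the induction for the Laplace transform.\<close>

lemma g_add_g_Suc: "g n t + g (Suc n) t = t ^ (2 * n + 2) / fact (2 * n + 2)"
proof -
  define c :: real where "c = (-1) ^ (n + 1)"
  define S where "S = (\<Sum>k=0..n. (-1) ^ k / fact (2 * k) * t ^ (2 * k))"
  define d where "d = t ^ (2 * n + 2) / fact (2 * n + 2)"
  have c: "c * c = 1" by (simp add: c_def flip: power_mult_distrib)
  have "(\<Sum>k=0..Suc n. (-1) ^ k / fact (2 * k) * t ^ (2 * k)) = S + c * d"
    by (simp add: S_def c_def d_def)
  then have "g (Suc n) t = - c * (cos t - (S + c * d))"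
    by (simp add: g_def c_def)
  moreover have "g n t = c * (cos t - S)"
    by (simp only: g_def c_def S_def)
  ultimately have "g n t + g (Suc n) t = (c * c) * d"
    by (simp add: algebra_simps)
  then show ?thesis unfolding c d_def by simp
qed

text \<open>Here \<^term>\<open>g 0\<close> is \<open>1 - cos\<close>, and an explicit antiderivative is available.\<close>

lemma laplace_g_0:
  fixes u :: real
  assumes u: "u > 0"
  shows "(\<integral>\<^sup>+t\<in>{0<..}. ennreal (g 0 t * exp (- (t * u))) \<partial>lborel) = ennreal (1 / (u * (1 + u\<^sup>2)))"
proof -
  \<comment> \<open>The second summand comes from integrating \<open>cos t * exp (- t u)\<close> by parts twice.\<close>
  define F where "F t = - exp (- (t * u)) * (1 / u + (sin t - u * cos t) / (1 + u\<^sup>2))" for t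
  have pos: "1 + u\<^sup>2 > 0" by (simp add: add_pos_nonneg)
  have "(F has_real_derivative g 0 t * exp (- (t * u))) (at t)" for t
  proof -
    have "(F has_real_derivative
        exp (- (t * u)) * u * (1 / u + (sin t - u * cos t) / (1 + u\<^sup>2))
        - exp (- (t * u)) * ((cos t + u * sin t) / (1 + u\<^sup>2))) (at t)"
      unfolding F_def using pos u by (auto intro!: derivative_eq_intros)
    also have "exp (- (t * u)) * u * (1 / u + (sin t - u * cos t) / (1 + u\<^sup>2))
        - exp (- (t * u)) * ((cos t + u * sin t) / (1 + u\<^sup>2))
      = exp (- (t * u)) * (1 + (u * (sin t - u * cos t) - (cos t + u * sin t)) / (1 + u\<^sup>2))"
    proof -
      have "e * u * (1 / u + S / D) - e * (T / D) = e * (1 + (u * S - T) / D)" for e S T D :: real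
      proof -
        have "e * u * (1 / u + S / D) = e * (1 + u * S / D)"
          using u by (simp add: distrib_left)
        then show ?thesis by (simp add: diff_divide_distrib algebra_simps)
      qed
      then show ?thesis .
    qed
    also have "u * (sin t - u * cos t) - (cos t + u * sin t) = - cos t * (1 + u\<^sup>2)"
      by (simp add: algebra_simps power2_eq_square)
    also have "exp (- (t * u)) * (1 + - cos t * (1 + u\<^sup>2) / (1 + u\<^sup>2)) = g 0 t * exp (- (t * u))"
      using pos by (simp add: g_def)
    finally show ?thesis .
  qed
  moreover have "(F \<longlongrightarrow> 0) at_top"
  proof (rule Lim_null_comparison)
    show "\<forall>\<^sub>F t in at_top. norm (F t) \<le> exp (- (t * u)) * (1 / u + (1 + u) / (1 + u\<^sup>2))"
    proof (intro always_eventually allI)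
      fix t
      have "\<bar>sin t - u * cos t\<bar> \<le> \<bar>sin t\<bar> + u * \<bar>cos t\<bar>"
        using abs_triangle_ineq4[of "sin t" "u * cos t"] u by (simp add: abs_mult)
      also have "\<dots> \<le> 1 + u * 1"
        using u by (intro add_mono mult_left_mono) auto
      finally have "\<bar>(sin t - u * cos t) / (1 + u\<^sup>2)\<bar> \<le> (1 + u) / (1 + u\<^sup>2)"
        using pos by (simp add: divide_right_mono)
      then have "\<bar>1 / u + (sin t - u * cos t) / (1 + u\<^sup>2)\<bar> \<le> 1 / u + (1 + u) / (1 + u\<^sup>2)"
        using u by (intro order.trans[OF abs_triangle_ineq] add_mono) auto
      then show "norm (F t) \<le> exp (- (t * u)) * (1 / u + (1 + u) / (1 + u\<^sup>2))"
        by (simp add: F_def abs_mult)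
    qed
    show "((\<lambda>t. exp (- (t * u)) * (1 / u + (1 + u) / (1 + u\<^sup>2))) \<longlongrightarrow> 0) at_top"
      using u by real_asymp
  qed
  ultimately have "(\<integral>\<^sup>+t\<in>{0..}. ennreal (g 0 t * exp (- (t * u))) \<partial>lborel) = 0 - F 0"
    by (intro nn_integral_FTC_atLeast) (auto simp: g_nonneg)
  also have "0 - F 0 = 1 / (u * (1 + u\<^sup>2))"
    using u pos by (simp add: F_def divide_simps) (simp add: algebra_simps power2_eq_square)
  finally show ?thesis
    by (simp add: nn_integral_Ioi_eq_Ici)
qed

text \<open>By the previous recurrence, the transforms for \<open>n\<close> and \<open>n + 1\<close> add up to that of
  \<open>t ^ (2n + 2) / (2n + 2)!\<close>, which is \<open>1 / u ^ (2n + 3)\<close>; since the transform for \<open>n\<close> is finite,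
  it can be cancelled in \<^typ>\<open>ennreal\<close>.\<close>

lemma laplace_g:
  fixes u :: real
  assumes u: "u > 0"
  shows "(\<integral>\<^sup>+t\<in>{0<..}. ennreal (g n t * exp (- (t * u))) \<partial>lborel)
       = ennreal (1 / (u ^ (2 * n + 1) * (1 + u\<^sup>2)))"
proof (induction n)
  case 0
  have "1 / (u ^ (2 * 0 + 1) * (1 + u\<^sup>2)) = 1 / (u * (1 + u\<^sup>2))" by simp
  then show ?case using laplace_g_0[OF u] by (simp only:)
next
  case (Suc n)
  let ?L = "\<lambda>n. \<integral>\<^sup>+t\<in>{0<..}. ennreal (g n t * exp (- (t * u))) \<partial>lborel"
  have pos: "1 + u\<^sup>2 > 0" by (simp add: add_pos_nonneg)
  have "?L n + ?L (Suc n)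
      = (\<integral>\<^sup>+t. ennreal (g n t * exp (- (t * u))) * indicator {0<..} t
           + ennreal (g (Suc n) t * exp (- (t * u))) * indicator {0<..} t \<partial>lborel)"
    by (rule nn_integral_add [symmetric]) measurable
  also have "\<dots> = (\<integral>\<^sup>+t. ennreal (1 / fact (2 * n + 2)) *
      (ennreal (t ^ (2 * n + 2) * exp (- (t * u))) * indicator {0<..} t) \<partial>lborel)"
  proof (intro nn_integral_cong)
    fix t :: real
    have "g n t * exp (- (t * u)) + g (Suc n) t * exp (- (t * u))
        = 1 / fact (2 * n + 2) * (t ^ (2 * n + 2) * exp (- (t * u)))"
      unfolding distrib_right [symmetric] g_add_g_Suc by (simp only: times_divide_eq_left mult_1_left)
    then have "ennreal (g n t * exp (- (t * u))) + ennreal (g (Suc n) t * exp (- (t * u)))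
        = ennreal (1 / fact (2 * n + 2)) * ennreal (t ^ (2 * n + 2) * exp (- (t * u)))"
      by (subst ennreal_plus [symmetric] ennreal_mult' [symmetric]; simp only: g_nonneg exp_ge_zero
          mult_nonneg_nonneg zero_le_divide_1_iff fact_ge_zero)+
    then show "ennreal (g n t * exp (- (t * u))) * indicator {0<..} t
        + ennreal (g (Suc n) t * exp (- (t * u))) * indicator {0<..} t
      = ennreal (1 / fact (2 * n + 2)) *
          (ennreal (t ^ (2 * n + 2) * exp (- (t * u))) * indicator {0<..} t)"
      by (cases "t > 0") (simp_all only: indicator_simps greaterThan_iff mult_1_right mult_zero_right add_0_right not_False_eq_True)
  qed
  also have "\<dots> = ennreal (1 / fact (2 * n + 2)) *
      (\<integral>\<^sup>+t\<in>{0<..}. ennreal (t ^ (2 * n + 2) * exp (- (t * u))) \<partial>lborel)"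
    by (intro nn_integral_cmult) measurable
  also have "\<dots> = ennreal (1 / u ^ (2 * n + 3))"
  proof -
    have "1 / fact (2 * n + 2) * (fact (2 * n + 2) / u ^ Suc (2 * n + 2)) = 1 / u ^ Suc (2 * n + 2)"
      using fact_nonzero[of "2 * n + 2", where 'a = real] by (simp del: fact_Suc power_Suc)
    moreover have "Suc (2 * n + 2) = 2 * n + 3" by simp
    ultimately show ?thesis
      unfolding nn_integral_power_times_exp[OF u] by (subst ennreal_mult' [symmetric]) (simp_all only: zero_le_divide_1_iff fact_ge_zero)
  qed
  finally have sum: "?L n + ?L (Suc n) = ennreal (1 / u ^ (2 * n + 3))" .
  have eq: "1 / u ^ (2 * n + 3)
      = 1 / (u ^ (2 * n + 1) * (1 + u\<^sup>2)) + 1 / (u ^ (2 * Suc n + 1) * (1 + u\<^sup>2))"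
  proof -
    define A where "A = u ^ (2 * n + 1)"
    have "A > 0" using u by (simp add: A_def)
    have "u ^ (2 * n + 3) = A * u\<^sup>2" "u ^ (2 * Suc n + 1) = A * u\<^sup>2"
      by (simp_all add: A_def power_add power2_eq_square power3_eq_cube)
    moreover have "1 / (A * u\<^sup>2) = (u\<^sup>2 + 1) / (A * u\<^sup>2 * (1 + u\<^sup>2))"
      using \<open>A > 0\<close> u pos by (simp add: divide_simps)
    moreover have "\<dots> = 1 / (A * (1 + u\<^sup>2)) + 1 / (A * u\<^sup>2 * (1 + u\<^sup>2))"
      using u by (simp add: add_divide_distrib)
    ultimately show ?thesis by (simp only: A_def)
  qed
  define A where "A = 1 / (u ^ (2 * n + 1) * (1 + u\<^sup>2))"
  define B where "B = 1 / (u ^ (2 * Suc n + 1) * (1 + u\<^sup>2))"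
  have "A \<ge> 0" "B \<ge> 0"
    using u pos unfolding A_def B_def by (intro divide_nonneg_pos mult_pos_pos zero_less_power; simp)+
  then have "ennreal A + ?L (Suc n) = ennreal A + ennreal B"
    using sum unfolding Suc.IH eq A_def [symmetric] B_def [symmetric] by (simp only: ennreal_plus)
  then have "?L (Suc n) = ennreal B"
    using ennreal_neq_top[of A] unfolding ennreal_add_left_cancel infinity_ennreal_def by blast
  then show ?case
    unfolding B_def .
qed

section \<open>Powers as integrals of the cosine remainder\<close>

lemma sin_constant_pos:
  fixes s :: real
  assumes "2 * real n < s" "s < 2 * real n + 2"
  shows "sin ((s - 2 * real n) * pi / 2) > 0"
proof (rule sin_gt_zero)
  show "0 < (s - 2 * real n) * pi / 2" using assms by simp
  have "(s - 2 * real n) * pi < 2 * pi" using assms by (intro mult_strict_right_mono) auto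
  then show "(s - 2 * real n) * pi / 2 < pi" by simp
qed

text \<open>Tonelli's theorem turns the integral into one of \<open>u powr s\<close> against the Laplace transform of
  \<^term>\<open>g n\<close>.\<close>

lemma mellin_g:
  fixes s :: real
  assumes s: "2 * real n < s" "s < 2 * real n + 2"
  shows "(\<integral>\<^sup>+t\<in>{0<..}. ennreal (g n t / t powr (s + 1)) \<partial>lborel)
       = ennreal (pi / (2 * Gamma (s + 1) * sin ((s - 2 * real n) * pi / 2)))"
    (is "?I = _")
proof -
  have s0: "s > 0" using s by (simp add: order.strict_trans1[of 0 "2 * real n"])
  have Gam: "Gamma (s + 1) > 0" using s0 by (intro Gamma_real_pos) simp
  let ?f = "\<lambda>t u. ennreal (g n t * (u powr s * exp (- (t * u))))"
  have "ennreal (Gamma (s + 1)) * ?I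
      = (\<integral>\<^sup>+t. ennreal (Gamma (s + 1)) * (ennreal (g n t / t powr (s + 1)) * indicator {0<..} t) \<partial>lborel)"
    by (intro nn_integral_cmult [symmetric]) measurable
  also have "\<dots> = (\<integral>\<^sup>+t\<in>{0<..}. (\<integral>\<^sup>+u\<in>{0<..}. ?f t u \<partial>lborel) \<partial>lborel)"
  proof (intro nn_integral_cong)
    fix t :: real
    show "ennreal (Gamma (s + 1)) * (ennreal (g n t / t powr (s + 1)) * indicator {0<..} t)
        = (\<integral>\<^sup>+u\<in>{0<..}. ?f t u \<partial>lborel) * indicator {0<..} t"
    proof (cases "t > 0")
      case t: True
      have "(\<integral>\<^sup>+u\<in>{0<..}. ?f t u \<partial>lborel)
          = (\<integral>\<^sup>+u. ennreal (g n t) * (ennreal (u powr (s + 1 - 1) * exp (- (t * u))) * indicator {0<..} u) \<partial>lborel)"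
        by (intro nn_integral_cong) (auto simp: indicator_def ennreal_mult' g_nonneg)
      also have "\<dots> = ennreal (g n t) * (\<integral>\<^sup>+u\<in>{0<..}. ennreal (u powr (s + 1 - 1) * exp (- (t * u))) \<partial>lborel)"
        by (intro nn_integral_cmult) measurable
      also have "\<dots> = ennreal (g n t) * ennreal (Gamma (s + 1) / t powr (s + 1))"
        using t s0 by (subst nn_integral_powr_times_exp) auto
      also have "\<dots> = ennreal (Gamma (s + 1)) * ennreal (g n t / t powr (s + 1))"
        using Gam by (simp add: ennreal_mult' [symmetric] g_nonneg mult.commute)
      finally show ?thesis using t by simp
    qed simp
  qed
  also have "\<dots> = (\<integral>\<^sup>+u\<in>{0<..}. (\<integral>\<^sup>+t\<in>{0<..}. ?f t u \<partial>lborel) \<partial>lborel)"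
    by (intro nn_integral_Ioi_swap) measurable
  also have "\<dots> = (\<integral>\<^sup>+u\<in>{0<..}. ennreal (u powr (s - 2 * real n - 1) / (1 + u\<^sup>2)) \<partial>lborel)"
  proof (intro set_nn_integral_cong refl)
    fix u :: real assume "u \<in> space lborel \<inter> {0<..}"
    then have u: "u > 0" by simp
    have "(\<integral>\<^sup>+t\<in>{0<..}. ?f t u \<partial>lborel)
        = (\<integral>\<^sup>+t. ennreal (u powr s) * (ennreal (g n t * exp (- (t * u))) * indicator {0<..} t) \<partial>lborel)"
      by (intro nn_integral_cong) (auto simp: indicator_def ennreal_mult' [symmetric] mult_ac)
    also have "\<dots> = ennreal (u powr s) * (\<integral>\<^sup>+t\<in>{0<..}. ennreal (g n t * exp (- (t * u))) \<partial>lborel)"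
      by (intro nn_integral_cmult) measurable
    also have "\<dots> = ennreal (u powr s / (u ^ (2 * n + 1) * (1 + u\<^sup>2)))"
      by (subst laplace_g[OF u]) (simp add: ennreal_mult' [symmetric])
    also have "u ^ (2 * n + 1) = u powr (2 * real n + 1)"
      using powr_realpow[OF u, of "2 * n + 1"] by (simp add: add.commute)
    also have "u powr s / (u powr (2 * real n + 1) * (1 + u\<^sup>2)) = u powr (s - 2 * real n - 1) / (1 + u\<^sup>2)"
      by (simp add: powr_diff [symmetric] diff_diff_eq flip: divide_divide_eq_left)
    finally show "(\<integral>\<^sup>+t\<in>{0<..}. ?f t u \<partial>lborel)
        = ennreal (u powr (s - 2 * real n - 1) / (1 + u\<^sup>2))" .
  qed
  also have "\<dots> = ennreal (pi / (2 * sin ((s - 2 * real n) * pi / 2)))"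
    using s by (intro mellin_1_over_1_plus_square) auto
  finally have *: "ennreal (Gamma (s + 1)) * ?I = ennreal (pi / (2 * sin ((s - 2 * real n) * pi / 2)))" .
  have "?I = ennreal (1 / Gamma (s + 1)) * (ennreal (Gamma (s + 1)) * ?I)"
    using Gam by (simp add: mult.assoc [symmetric] ennreal_mult' [symmetric])
  also have "\<dots> = ennreal (pi / (2 * Gamma (s + 1) * sin ((s - 2 * real n) * pi / 2)))"
    unfolding * using Gam by (subst ennreal_mult' [symmetric]) (auto simp: mult_ac)
  finally show ?thesis .
qed

text \<open>The homogeneity of \<open>t powr (s + 1)\<close> together with the factor from \<open>dt\<close> leaves
  \<open>\<bar>x\<bar> powr s\<close>; as \<^term>\<open>g n\<close> is even, \<open>t x\<close> may be replaced by \<open>t \<bar>x\<bar>\<close>, so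
  that the scaling factor is positive.\<close>

lemma abs_powr_eq_nn_integral_g:
  fixes s x :: real
  assumes s: "2 * real n < s" "s < 2 * real n + 2"
  shows "ennreal (\<bar>x\<bar> powr s)
       = ennreal (2 / pi * Gamma (s + 1) * sin ((s - 2 * real n) * pi / 2)) *
         (\<integral>\<^sup>+t\<in>{0<..}. ennreal (g n (t * x) / t powr (s + 1)) \<partial>lborel)"
    (is "_ = ennreal ?C * ?I")
proof (cases "x = 0")
  case True
  have "g n 0 = 0"
    by (simp add: g_def power_0_left sum.atLeast_Suc_atMost)
  then show ?thesis using True by simp
next
  case False
  have s0: "s > 0" using s by (simp add: order.strict_trans1[of 0 "2 * real n"])
  have Gam: "Gamma (s + 1) > 0" using s0 by (intro Gamma_real_pos) simp
  note sin = sin_constant_pos[OF s]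
  define c where "c = \<bar>x\<bar>"
  have c: "c > 0" using False by (simp add: c_def)
  let ?J = "\<integral>\<^sup>+t\<in>{0<..}. ennreal (g n (c * t) / (c * t) powr (s + 1)) \<partial>lborel"
  have "?I = (\<integral>\<^sup>+t. ennreal (c powr (s + 1)) *
      (ennreal (g n (c * t) / (c * t) powr (s + 1)) * indicator {0<..} t) \<partial>lborel)"
  proof (intro nn_integral_cong)
    fix t :: real
    have "g n (t * x) = g n (c * t)" if "t > 0"
      using that g_abs[of n "t * x"] by (simp add: c_def abs_mult mult.commute)
    then show "ennreal (g n (t * x) / t powr (s + 1)) * indicator {0<..} t
        = ennreal (c powr (s + 1)) * (ennreal (g n (c * t) / (c * t) powr (s + 1)) * indicator {0<..} t)"
      using c by (auto simp: indicator_def ennreal_mult' [symmetric] powr_mult)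
  qed
  also have "\<dots> = ennreal (c powr (s + 1)) * ?J"
    by (intro nn_integral_cmult) measurable
  also have "\<dots> = ennreal (c powr s) * (ennreal c * ?J)"
    using c by (simp add: mult.assoc [symmetric] ennreal_mult' [symmetric] powr_add)
  also have "ennreal c * ?J = (\<integral>\<^sup>+t\<in>{0<..}. ennreal (g n t / t powr (s + 1)) \<partial>lborel)"
    using c by (intro nn_integral_Ioi_cmult_arg) measurable
  also have "\<dots> = ennreal (pi / (2 * Gamma (s + 1) * sin ((s - 2 * real n) * pi / 2)))"
    by (rule mellin_g[OF s])
  finally have "ennreal ?C * ?I
      = ennreal (?C * (c powr s * (pi / (2 * Gamma (s + 1) * sin ((s - 2 * real n) * pi / 2)))))"
    using Gam sin by (simp add: ennreal_mult' [symmetric])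
  also have "?C * (c powr s * (pi / (2 * Gamma (s + 1) * sin ((s - 2 * real n) * pi / 2)))) = c powr s"
    using Gam sin by (simp add: field_simps)
  finally show ?thesis by (simp add: c_def)
qed

section \<open>Taking expectations\<close>

lemma expectation_g_eq_G:
  assumes "prob_space M" and X [measurable]: "X \<in> borel_measurable M"
    and "\<And>k. k \<le> n \<Longrightarrow> integrable M (\<lambda>\<omega>. X \<omega> ^ (2 * k))"
  shows "integrable M (\<lambda>\<omega>. g n (t * X \<omega>))" and "(\<integral>\<omega>. g n (t * X \<omega>) \<partial>M) = G M X n t"
proof -
  interpret prob_space M by fact
  have cos: "integrable M (\<lambda>\<omega>. cos (t * X \<omega>))"
    by (rule integrable_const_bound[of _ 1]) auto
  have pow: "integrable M (\<lambda>\<omega>. (-1) ^ k / fact (2 * k) * (t * X \<omega>) ^ (2 * k))" if "k \<le> n" for k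
    using assms(3)[OF that] by (simp add: power_mult_distrib)
  show "integrable M (\<lambda>\<omega>. g n (t * X \<omega>))"
    unfolding g_def by (intro integrable_mult_right Bochner_Integration.integrable_diff Bochner_Integration.integrable_sum cos pow) auto
  have "Re (char (distr M borel X) t) = (\<integral>\<omega>. Re (iexp (t * X \<omega>)) \<partial>M)"
  proof -
    have "char (distr M borel X) t = (CLINT \<omega>|M. iexp (t * X \<omega>))"
      unfolding char_def by (intro integral_distr) auto
    moreover have "integrable M (\<lambda>\<omega>. iexp (t * X \<omega>))"
      by (intro integrable_iexp) auto
    ultimately show ?thesis by simp
  qed
  also have "\<dots> = (\<integral>\<omega>. cos (t * X \<omega>) \<partial>M)"
    by (simp add: Re_exp)
  finally have re: "Re (char (distr M borel X) t) = (\<integral>\<omega>. cos (t * X \<omega>) \<partial>M)" .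
  have "(\<integral>\<omega>. g n (t * X \<omega>) \<partial>M) = (-1) ^ (n + 1) * ((\<integral>\<omega>. cos (t * X \<omega>) \<partial>M)
      - (\<Sum>k=0..n. \<integral>\<omega>. (-1) ^ k / fact (2 * k) * (t * X \<omega>) ^ (2 * k) \<partial>M))"
    unfolding g_def using cos pow
    by (subst integral_mult_right_zero, subst Bochner_Integration.integral_diff)
       (auto intro!: Bochner_Integration.integrable_sum Bochner_Integration.integral_sum simp del: power_Suc integral_mult_right_zero times_divide_eq_left)
  also have "(\<Sum>k=0..n. \<integral>\<omega>. (-1) ^ k / fact (2 * k) * (t * X \<omega>) ^ (2 * k) \<partial>M)
      = (\<Sum>k=0..n. (-1) ^ k / fact (2 * k) * moment M X (2 * k) * t ^ (2 * k))"
    by (intro sum.cong) (auto simp: moment_def power_mult_distrib)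
  finally show "(\<integral>\<omega>. g n (t * X \<omega>) \<partial>M) = G M X n t"
    unfolding G_def re .
qed

theorem mainTheorem1:
  fixes M :: "'a measure" and X :: "'a \<Rightarrow> real" and n :: nat and s :: real
  assumes "prob_space M"
    and "X \<in> borel_measurable M"
    and "2 * real n < s" and "s < 2 * real n + 2"
  shows "abs_moment M X s =
           ennreal (2 / pi * Gamma (s + 1) * sin ((s - 2 * real n) * pi / 2)) *
           (\<integral>\<^sup>+ t\<in>{0<..}. (\<integral>\<^sup>+ \<omega>. ennreal (g n (t * X \<omega>)) \<partial>M) / ennreal (t powr (s + 1)) \<partial>lborel)
       \<and> (abs_moment M X s < \<infinity> \<longrightarrow>
           set_integrable lborel {0<..} (\<lambda>t. G M X n t / t powr (s + 1))
         \<and> enn2real (abs_moment M X s) =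
             2 / pi * Gamma (s + 1) * sin ((s - 2 * real n) * pi / 2) *
             (LBINT t:{0<..}. G M X n t / t powr (s + 1)))"
proof -
  interpret prob_space M by fact
  interpret lborel_M: pair_sigma_finite lborel M ..
  note [measurable] = assms(2)
  note s = assms(3,4)
  define C where "C = 2 / pi * Gamma (s + 1) * sin ((s - 2 * real n) * pi / 2)"
  have "s + 1 > 0" using s by (simp add: order.strict_trans1[of 0 "2 * real n"])
  then have C: "C > 0"
    using sin_constant_pos[OF s] by (simp add: C_def Gamma_real_pos)
  define N where "N = (\<integral>\<^sup>+ t\<in>{0<..}. (\<integral>\<^sup>+ \<omega>. ennreal (g n (t * X \<omega>)) \<partial>M) / ennreal (t powr (s + 1)) \<partial>lborel)"
  have "abs_moment M X s
      = (\<integral>\<^sup>+\<omega>. ennreal C * (\<integral>\<^sup>+t\<in>{0<..}. ennreal (g n (t * X \<omega>) / t powr (s + 1)) \<partial>lborel) \<partial>M)"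
    unfolding abs_moment_def C_def by (intro nn_integral_cong abs_powr_eq_nn_integral_g[OF s])
  also have "\<dots> = ennreal C * (\<integral>\<^sup>+\<omega>. (\<integral>\<^sup>+t\<in>{0<..}. ennreal (g n (t * X \<omega>) / t powr (s + 1)) \<partial>lborel) \<partial>M)"
    by (intro nn_integral_cmult) measurable
  also have "(\<integral>\<^sup>+\<omega>. (\<integral>\<^sup>+t\<in>{0<..}. ennreal (g n (t * X \<omega>) / t powr (s + 1)) \<partial>lborel) \<partial>M)
      = (\<integral>\<^sup>+t. (\<integral>\<^sup>+\<omega>. ennreal (g n (t * X \<omega>) / t powr (s + 1)) * indicator {0<..} t \<partial>M) \<partial>lborel)"
    by (intro lborel_M.Fubini') measurable
  also have "\<dots> = N"
    unfolding N_def
  proof (intro nn_integral_cong)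
    fix t :: real
    have "(\<integral>\<^sup>+\<omega>. ennreal (g n (t * X \<omega>) / t powr (s + 1)) * indicator {0<..} t \<partial>M)
        = (\<integral>\<^sup>+\<omega>. ennreal (g n (t * X \<omega>)) / ennreal (t powr (s + 1)) * indicator {0<..} t \<partial>M)"
      by (intro nn_integral_cong) (auto simp: indicator_def g_nonneg divide_ennreal)
    also have "\<dots> = (\<integral>\<^sup>+\<omega>. ennreal (g n (t * X \<omega>)) / ennreal (t powr (s + 1)) \<partial>M) * indicator {0<..} t"
      by (intro nn_integral_multc) measurable
    also have "(\<integral>\<^sup>+\<omega>. ennreal (g n (t * X \<omega>)) / ennreal (t powr (s + 1)) \<partial>M)
        = (\<integral>\<^sup>+\<omega>. ennreal (g n (t * X \<omega>)) \<partial>M) / ennreal (t powr (s + 1))"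
      by (intro nn_integral_divide) measurable
    finally show "(\<integral>\<^sup>+\<omega>. ennreal (g n (t * X \<omega>) / t powr (s + 1)) * indicator {0<..} t \<partial>M)
        = (\<integral>\<^sup>+\<omega>. ennreal (g n (t * X \<omega>)) \<partial>M) / ennreal (t powr (s + 1)) * indicator {0<..} t" .
  qed
  finally have eq: "abs_moment M X s = ennreal C * N" .
  have "set_integrable lborel {0<..} (\<lambda>t. G M X n t / t powr (s + 1))
      \<and> enn2real (abs_moment M X s) = C * (LBINT t:{0<..}. G M X n t / t powr (s + 1))"
    if fin: "abs_moment M X s < \<infinity>"
  proof -
    have int: "integrable M (\<lambda>\<omega>. X \<omega> ^ (2 * k))" if "k \<le> n" for k
      using assms(1-3) fin that by (rule integrable_even_moment)
    have G: "integrable M (\<lambda>\<omega>. g n (t * X \<omega>))" "(\<integral>\<omega>. g n (t * X \<omega>) \<partial>M) = G M X n t" for t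
      using int by (intro expectation_g_eq_G assms(1,2); simp)+
    have G_nonneg: "0 \<le> G M X n t" for t
      unfolding G(2) [symmetric] by (intro integral_nonneg_AE) (simp add: g_nonneg)
    have "(\<lambda>t. \<integral>\<omega>. g n (t * X \<omega>) \<partial>M) \<in> borel_measurable borel"
      by measurable
    then have [measurable]: "G M X n \<in> borel_measurable borel"
      unfolding G(2) .
    let ?h = "\<lambda>t. indicator {0<..} t *\<^sub>R (G M X n t / t powr (s + 1))"
    have "N = (\<integral>\<^sup>+t. ennreal (?h t) \<partial>lborel)"
      unfolding N_def
    proof (intro nn_integral_cong)
      fix t :: real
      have "(\<integral>\<^sup>+\<omega>. ennreal (g n (t * X \<omega>)) \<partial>M) = ennreal (G M X n t)"
        unfolding G(2) [symmetric] using G(1) by (intro nn_integral_eq_integral) (auto simp: g_nonneg)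
      then show "(\<integral>\<^sup>+\<omega>. ennreal (g n (t * X \<omega>)) \<partial>M) / ennreal (t powr (s + 1)) * indicator {0<..} t
          = ennreal (?h t)"
        by (auto simp: indicator_def G_nonneg divide_ennreal)
    qed
    \<comment> \<open>This uses \<open>C > 0\<close>: in \<^typ>\<open>ennreal\<close>, \<open>0 * \<infinity>\<close> is \<open>0\<close>.\<close>
    moreover have "N < \<infinity>"
      using fin C unfolding eq by (auto simp: ennreal_mult_less_top)
    ultimately have "integrable lborel ?h" and "enn2real N = (\<integral>t. ?h t \<partial>lborel)"
      by (auto intro!: integrableI_nonneg simp: integral_eq_nn_integral G_nonneg)
    then show ?thesis
      using C by (simp add: eq enn2real_mult set_integrable_def set_lebesgue_integral_def)
  qed
  with eq show ?thesis unfolding N_def C_def by blast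
qed

end
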